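(* Let $G$ be a finite simple graph and let $(G,\pm)$ be the signed graph obtained from $G$ by replacing every edge by a positive--negative digon. Then $$\mathrm{BSTAB}(G,\pm)=\mathrm{STAB}(G),\qquad \mathrm{BTH}(G,\pm)=\mathrm{TH}(G),\qquad \mathrm{BQSTAB}(G,\pm)=\mathrm{QSTAB}(G).$$
   Context: Signed graphs. A signed graph is a pair $\Sigma=(G,\sigma)$ with $G$ a finite graph and $\sigma:E(G)\to\{+1,-1\}$. Positive loops are allowed, negative loops are excluded; between two distinct vertices there may be both a positive and a negative edge (a digon); repeated edges of the same sign are immaterial. Convention: every signed graph is replaced by its completion having a positive loop at every vertex. A signed graph is balanced if every cycle has positive sign (product of edge signs; a digon is a negative cycle); a set $B\subseteq V(\Sigma)$ is balanced if the induced signed graph $\Sigma[B]$ is balanced. Conflict graph. $C(\Sigma)$ is the ordinary simple graph on $V(\Sigma)\times\{\pm1\}$ with $(u,s)\sim(v,r)$ iff there is an edge $e=uv$ of $\Sigma$ (possibly a loop, $u=v$) with $r=-\sigma(e)s$. In particular $(v,+)\sim(v,-)$ for all $v$. Ordinary bodies. For a finite simple graph $H$: $\mathrm{STAB}(H)=\operatorname{conv}\{\mathbf 1_I: I\text{ stable in }H\}$; $\mathrm{QSTAB}(H)=\{x\ge0: x(K)\le1\text{ for every clique }K\}$, with $x(K)=\sum_{v\in K}x_v$; $\mathrm{TH}(H)=\{x:\exists\, X\text{ symmetric with }\begin{pmatrix} 1 & x^{\mathsf T} \\ x & X \end{pmatrix}\succeq0,\ \operatorname{diag}X=x,\ X_{uv}=0\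 (uv\in E(H))\}$. Signed bodies. Let $p:\mathbb R^{V(\Sigma)\times\{\pm1\}}\to\mathbb R^{V(\Sigma)}$, $p(y)_v=y_{(v,+)}+y_{(v,-)}$. Then $\mathrm{BSTAB}(\Sigma)=\operatorname{conv}\{\mathbf 1_B:B\subseteq V(\Sigma)\text{ balanced}\}$, $\mathrm{BTH}(\Sigma)=p(\mathrm{TH}(C(\Sigma)))$, and $\mathrm{BQSTAB}(\Sigma)=p(\mathrm{QSTAB}(C(\Sigma)))$. *)

theory Defs
  imports "HOL-Analysis.Analysis" "HOL-Library.Ramsey"
begin

text \<open>
  The vertex set of a graph is the whole of a finite type \<open>'v\<close>, so that the bodies live in
  \<open>real ^ 'v\<close>; a graph is given by its edges.
\<close>

definition simple_graph :: "'v set set \<Rightarrow> bool" where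
  "simple_graph E \<longleftrightarrow> (\<forall>e\<in>E. card e = 2)"

definition indicator_vec :: "'v set \<Rightarrow> real ^ 'v::finite" where
  "indicator_vec S = (\<chi> v. indicator S v)"

text \<open>The stable sets and the cliques of \<open>E\<close> are those of the library, \<^const>\<open>indep\<close> and
  \<^const>\<open>clique\<close>.\<close>

definition STAB :: "'v set set \<Rightarrow> (real ^ 'v::finite) set" where
  "STAB E = convex hull {indicator_vec I |I. indep I E}"

definition QSTAB :: "'v set set \<Rightarrow> (real ^ 'v::finite) set" where
  "QSTAB E = {x. (\<forall>v. 0 \<le> x $ v) \<and> (\<forall>K. clique K E \<longrightarrow> (\<Sum>v\<in>K. x $ v) \<le> 1)}"

definition psd :: "real ^ 'n ^ 'n::finite \<Rightarrow> bool" where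
  "psd M \<longleftrightarrow> transpose M = M \<and> (\<forall>z. 0 \<le> z \<bullet> (M *v z))"

text \<open>The bordered matrix with first row \<open>(1, x\<^sup>T)\<close> and remaining rows \<open>(x, X)\<close>; the index
  \<^const>\<open>None\<close> is the additional first one.\<close>

definition bordered :: "real ^ 'v \<Rightarrow> real ^ 'v ^ 'v \<Rightarrow> real ^ 'v option ^ ('v::finite) option" where
  "bordered x X = (\<chi> i j. case (i, j) of
      (None, None) \<Rightarrow> 1
    | (None, Some v) \<Rightarrow> x $ v
    | (Some u, None) \<Rightarrow> x $ u
    | (Some u, Some v) \<Rightarrow> X $ u $ v)"

definition TH :: "'v set set \<Rightarrow> (real ^ 'v::finite) set" where
  "TH E = {x. \<exists>X. transpose X = X \<and> psd (bordered x X) \<and> (\<forall>v. X $ v $ v = x $ v) \<and>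
                  (\<forall>u v. {u, v} \<in> E \<longrightarrow> X $ u $ v = 0)}"


datatype sign = Positive | Negative

lemma UNIV_sign: "(UNIV :: sign set) = {Positive, Negative}"
  using sign.exhaust by blast

instance sign :: finite
  by standard (simp add: UNIV_sign)

fun sign_val :: "sign \<Rightarrow> int" where
  "sign_val Positive = 1"
| "sign_val Negative = - 1"

text \<open>
  A signed edge is the pair of its set of end vertices (a singleton for a loop) and its sign.
  A signed graph is the set of its signed edges: it can contain both signed versions of an
  edge (a digon), and repeated edges of the same sign are identified.
\<close>

type_synonym 'v sgraph = "('v set \<times> sign) set"

definition signed_graph :: "'v sgraph \<Rightarrow> bool" where
  "signed_graph \<Sigma> \<longleftrightarrow> (\<forall>(e, s)\<in>\<Sigma>. card e = 2 \<or> (card e = 1 \<and> s = Positive))"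

definition completion :: "'v sgraph \<Rightarrow> 'v sgraph" where
  "completion \<Sigma> = \<Sigma> \<union> {({v}, Positive) |v. True}"

definition induced :: "'v sgraph \<Rightarrow> 'v set \<Rightarrow> 'v sgraph" where
  "induced \<Sigma> B = {(e, s) \<in> \<Sigma>. e \<subseteq> B}"

text \<open>A cycle with vertices \<open>v\<^sub>0, \<dots>, v\<^sub>k\<^sub>-\<^sub>1\<close> (\<open>k \<ge> 1\<close>) whose edge from \<open>v\<^sub>i\<close> to
  \<open>v\<^sub>i\<^sub>+\<^sub>1\<close> (cyclically) has sign \<open>s\<^sub>i\<close>. A loop is a cycle with \<open>k = 1\<close>. For \<open>k = 2\<close>,
  distinctness of the edges means that the cycle is a digon.\<close>

definition cycle_edges :: "'v list \<Rightarrow> sign list \<Rightarrow> ('v set \<times> sign) list" where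
  "cycle_edges vs ss = map (\<lambda>i. ({vs ! i, vs ! (Suc i mod length vs)}, ss ! i)) [0..<length vs]"

definition is_cycle :: "'v sgraph \<Rightarrow> 'v list \<Rightarrow> sign list \<Rightarrow> bool" where
  "is_cycle \<Sigma> vs ss \<longleftrightarrow> vs \<noteq> [] \<and> length ss = length vs \<and> distinct vs \<and>
     distinct (cycle_edges vs ss) \<and> set (cycle_edges vs ss) \<subseteq> \<Sigma>"

definition balanced :: "'v sgraph \<Rightarrow> bool" where
  "balanced \<Sigma> \<longleftrightarrow> (\<forall>vs ss. is_cycle \<Sigma> vs ss \<longrightarrow> prod_list (map sign_val ss) = 1)"

definition balanced_set :: "'v sgraph \<Rightarrow> 'v set \<Rightarrow> bool" where
  "balanced_set \<Sigma> B \<longleftrightarrow> balanced (induced \<Sigma> B)"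

definition conflict_graph :: "'v sgraph \<Rightarrow> ('v \<times> sign) set set" where
  "conflict_graph \<Sigma> = {{(u, s), (v, r)} |u s v r.
     \<exists>\<tau>. ({u, v}, \<tau>) \<in> \<Sigma> \<and> sign_val r = - sign_val \<tau> * sign_val s}"

definition proj :: "real ^ ('v \<times> sign) \<Rightarrow> real ^ 'v::finite" where
  "proj y = (\<chi> v. y $ (v, Positive) + y $ (v, Negative))"

definition BSTAB :: "'v sgraph \<Rightarrow> (real ^ 'v::finite) set" where
  "BSTAB \<Sigma> = convex hull {indicator_vec B |B. balanced_set \<Sigma> B}"

definition BTH :: "'v sgraph \<Rightarrow> (real ^ 'v::finite) set" where
  "BTH \<Sigma> = proj ` TH (conflict_graph \<Sigma>)"

definition BQSTAB :: "'v sgraph \<Rightarrow> (real ^ 'v::finite) set" where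
  "BQSTAB \<Sigma> = proj ` QSTAB (conflict_graph \<Sigma>)"

text \<open>\<open>(G, \<plusminus>)\<close>, before completion.\<close>

definition doubled :: "'v set set \<Rightarrow> 'v sgraph" where
  "doubled E = E \<times> {Positive, Negative}"


lemma signed_graph_completion: "signed_graph \<Sigma> \<Longrightarrow> signed_graph (completion \<Sigma>)"
  by (auto simp: signed_graph_def completion_def)

lemma signed_graph_doubled: "simple_graph E \<Longrightarrow> signed_graph (doubled E)"
  by (auto simp: signed_graph_def doubled_def simple_graph_def)

lemma simple_graph_conflict_graph:
  assumes "signed_graph \<Sigma>"
  shows "simple_graph (conflict_graph \<Sigma>)"
  unfolding simple_graph_def
proof
  fix e assume "e \<in> conflict_graph \<Sigma>"
  then obtain u s v r \<tau> where e: "e = {(u, s), (v, r)}" and \<tau>: "({u, v}, \<tau>) \<in> \<Sigma>"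
    and r: "sign_val r = - sign_val \<tau> * sign_val s"
    by (auto simp: conflict_graph_def)
  have "(u, s) \<noteq> (v, r)"
  proof
    assume eq: "(u, s) = (v, r)"
    with \<tau> assms have "\<tau> = Positive"
      by (auto simp: signed_graph_def)
    with r eq show False
      by (cases r) auto
  qed
  then show "card e = 2"
    by (simp add: e)
qed

lemma conflict_graph_edge_iff:
  "{(u, s), (v, r)} \<in> conflict_graph \<Sigma> \<longleftrightarrow>
     (\<exists>\<tau>. ({u, v}, \<tau>) \<in> \<Sigma> \<and> sign_val r = - sign_val \<tau> * sign_val s)"
proof
  assume "{(u, s), (v, r)} \<in> conflict_graph \<Sigma>"
  then obtain u' s' v' r' \<tau> where e: "{(u, s), (v, r)} = {(u', s'), (v', r')}"
    and \<tau>: "({u', v'}, \<tau>) \<in> \<Sigma>" and r: "sign_val r' = - sign_val \<tau> * sign_val s'"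
    unfolding conflict_graph_def by blast
  have r': "sign_val s' = - sign_val \<tau> * sign_val r'"
    using r by (cases \<tau>) auto
  show "\<exists>\<tau>. ({u, v}, \<tau>) \<in> \<Sigma> \<and> sign_val r = - sign_val \<tau> * sign_val s"
    using e \<tau> r r' by (auto simp: doubleton_eq_iff insert_commute)
qed (unfold conflict_graph_def, blast)

lemma conflict_graph_completion: "{(v, Positive), (v, Negative)} \<in> conflict_graph (completion \<Sigma>)"
  by (auto simp: conflict_graph_edge_iff completion_def)

end

theory Submission
  imports Defs
begin

text \<open>
  The conflict graph of \<open>(G, \<plusminus>)\<close> is the lexicographic product \<open>G[K\<^sub>2]\<close>: two vertices over
  distinct base points are adjacent iff the base points are, whatever their signs. So summing
  over the two signs maps \<open>TH\<close> and \<open>QSTAB\<close> of the product into those of \<open>G\<close>, and the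
  extension by zero on the negative copy is a section of this map. A set containing an edge of
  \<open>G\<close> contains a digon, and otherwise it induces positive loops only.
\<close>

lemma sum_UNIV_sign: "(\<Sum>s\<in>UNIV. f s) = f Positive + (f Negative :: 'a::comm_monoid_add)"
  by (simp add: UNIV_sign)

lemma sum_times_sign:
  "(\<Sum>p\<in>A \<times> (UNIV :: sign set). f p) = (\<Sum>v\<in>A. f (v, Positive) + (f (v, Negative) :: 'a::comm_monoid_add))"
proof -
  have "(\<Sum>p\<in>A \<times> UNIV. f p) = (\<Sum>v\<in>A. \<Sum>s\<in>UNIV. f (v, s))"
    by (simp add: sum.cartesian_product)
  then show ?thesis
    by (simp add: sum_UNIV_sign)
qed

lemma sum_UNIV_times_sign:
  "(\<Sum>p\<in>UNIV. f p) = (\<Sum>v\<in>UNIV. f (v :: 'v::finite, Positive) + (f (v, Negative) :: 'a::comm_monoid_add))"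
  using sum_times_sign[of f UNIV] by simp

lemma doubled_edge_iff:
  assumes "simple_graph E"
  shows "({u, v}, \<tau>) \<in> completion (doubled E) \<longleftrightarrow> {u, v} \<in> E \<or> (u = v \<and> \<tau> = Positive)"
  using assms by (cases \<tau>) (auto simp: completion_def doubled_def simple_graph_def)

text \<open>Over an edge of \<open>E\<close> both signs \<open>\<tau>\<close> occur, so one of them
  meets the sign condition for any \<open>s\<close> and \<open>r\<close>. Over a single vertex there
  is only the positive loop, which forces opposite signs.\<close>

lemma conflict_graph_doubled_iff:
  assumes "simple_graph E"
  shows "{(u, s), (v, r)} \<in> conflict_graph (completion (doubled E)) \<longleftrightarrow>
    {u, v} \<in> E \<or> (u = v \<and> s \<noteq> r)"
proof -
  have "\<exists>\<tau>. sign_val r = - sign_val \<tau> * sign_val s"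
    by (rule exI[of _ "if s = r then Negative else Positive"]) (cases s; cases r; simp)
  moreover have "sign_val r = - sign_val Positive * sign_val s \<longleftrightarrow> s \<noteq> r"
    by (cases s; cases r; simp)
  ultimately show ?thesis
    unfolding conflict_graph_edge_iff doubled_edge_iff[OF assms] by blast
qed

lemma balanced_set_doubled_iff:
  assumes "simple_graph E"
  shows "balanced_set (completion (doubled E)) B \<longleftrightarrow> indep B E"
proof
  assume bal: "balanced_set (completion (doubled E)) B"
  show "indep B E"
    unfolding indep_def
  proof (intro ballI impI notI)
    fix u v assume uv: "u \<in> B" "v \<in> B" "u \<noteq> v" "{u, v} \<in> E"
    \<comment> \<open>The digon on \<open>u\<close> and \<open>v\<close> is a cycle of length 2: its
      edges share their ends but differ in sign, and their product is -1.\<close>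
    then have "is_cycle (induced (completion (doubled E)) B) [u, v] [Positive, Negative]"
      by (auto simp: is_cycle_def cycle_edges_def induced_def doubled_def completion_def insert_commute)
    with bal show False
      by (fastforce simp: balanced_set_def balanced_def)
  qed
next
  assume indep: "indep B E"
  \<comment> \<open>A negative edge can only come from \<open>doubled E\<close>, so its ends would
    be two adjacent vertices of \<open>B\<close>. Hence every cycle inside \<open>B\<close> has
    positive edges only.\<close>
  have positive: "s = Positive" if "(e, s) \<in> induced (completion (doubled E)) B" for e s
  proof (rule ccontr)
    assume "s \<noteq> Positive"
    with that have "e \<in> E" "e \<subseteq> B"
      by (auto simp: induced_def completion_def doubled_def)
    moreover from \<open>e \<in> E\<close> assms obtain u v where "e = {u, v}" "u \<noteq> v"
      by (auto simp: simple_graph_def card_2_iff)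
    ultimately show False
      using indep by (auto simp: indep_def)
  qed
  show "balanced_set (completion (doubled E)) B"
    unfolding balanced_set_def balanced_def
  proof (intro allI impI)
    fix vs ss assume cyc: "is_cycle (induced (completion (doubled E)) B) vs ss"
    have "ss ! i = Positive" if "i < length ss" for i
    proof (rule positive)
      show "({vs ! i, vs ! (Suc i mod length vs)}, ss ! i) \<in> induced (completion (doubled E)) B"
        using cyc that by (auto simp: is_cycle_def cycle_edges_def)
    qed
    then have "ss = replicate (length ss) Positive"
      by (auto intro: nth_equalityI)
    then show "prod_list (map sign_val ss) = 1"
      by (metis map_replicate power_one prod_list_replicate sign_val.simps(1))
  qed
qed

lemma sum_UNIV_option:
  fixes f :: "'v::finite option \<Rightarrow> 'a::comm_monoid_add"
  shows "(\<Sum>i\<in>UNIV. f i) = f None + (\<Sum>v\<in>UNIV. f (Some v))"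
  by (simp add: UNIV_option_conv sum.reindex)

lemma bordered_quadratic_form:
  fixes x :: "real ^ 'v::finite"
  assumes "z = (\<chi> i. case i of None \<Rightarrow> c | Some v \<Rightarrow> w $ v)"
  shows "z \<bullet> (bordered x X *v z) = c\<^sup>2 + 2 * c * (x \<bullet> w) + w \<bullet> (X *v w)"
  unfolding assms
  by (simp add: bordered_def inner_vec_def matrix_vector_mult_def sum_UNIV_option
      power2_eq_square algebra_simps sum.distrib sum_distrib_left sum_distrib_right)

text \<open>Splitting off the border coordinate \<open>c\<close> leaves a form in \<open>w\<close>
  alone, on which a change of variables acts directly. The equivalence also supplies the symmetry of
  \<open>X\<close> that \<open>TH\<close> demands separately.\<close>

lemma psd_bordered_iff:
  fixes x :: "real ^ 'v::finite"
  shows "psd (bordered x X) \<longleftrightarrow> transpose X = X \<and>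
    (\<forall>c w. 0 \<le> c\<^sup>2 + 2 * c * (x \<bullet> w) + w \<bullet> (X *v w))"
proof -
  have "transpose (bordered x X) = bordered x X \<longleftrightarrow> transpose X = X"
    by (auto simp: bordered_def transpose_def vec_eq_iff split_option_all split: option.splits)
  moreover have "(\<forall>z. 0 \<le> z \<bullet> (bordered x X *v z)) \<longleftrightarrow>
    (\<forall>c w. 0 \<le> c\<^sup>2 + 2 * c * (x \<bullet> w) + w \<bullet> (X *v w))"
  proof (intro iffI allI)
    fix z :: "real ^ 'v option"
    assume "\<forall>c w. 0 \<le> c\<^sup>2 + 2 * c * (x \<bullet> w) + w \<bullet> (X *v w)"
    moreover have "z = (\<chi> i. case i of None \<Rightarrow> z $ None | Some v \<Rightarrow> (\<chi> v. z $ Some v) $ v)"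
      by (simp add: vec_eq_iff split: option.split)
    ultimately show "0 \<le> z \<bullet> (bordered x X *v z)"
      using bordered_quadratic_form by metis
  qed (metis bordered_quadratic_form)
  ultimately show ?thesis
    by (simp add: psd_def)
qed

text \<open>The new form at \<open>(c, w)\<close> is the old one at \<open>(c, P *v w)\<close>. As
  \<open>P\<close> may be rectangular, this serves both for summing over signs and for extending by
  zero.\<close>

lemma psd_bordered_congruence:
  fixes P :: "real ^ 'n::finite ^ 'm::finite"
  assumes "psd (bordered x X)"
  shows "psd (bordered (transpose P *v x) (transpose P ** X ** P))"
proof -
  have adjoint: "(transpose P *v u) \<bullet> w = u \<bullet> (P *v w)" for u w
    by (simp add: dot_lmul_matrix)
  have "w \<bullet> ((transpose P ** X ** P) *v w) = (P *v w) \<bullet> (X *v (P *v w))" for w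
  proof -
    have "w \<bullet> ((transpose P ** X ** P) *v w) = (transpose P *v (X *v (P *v w))) \<bullet> w"
      by (simp only: matrix_vector_mul_assoc matrix_mul_assoc inner_commute)
    also have "\<dots> = (P *v w) \<bullet> (X *v (P *v w))"
      by (metis adjoint inner_commute)
    finally show ?thesis .
  qed
  with adjoint show ?thesis
    using assms by (simp add: psd_bordered_iff matrix_transpose_mul matrix_mul_assoc)
qed

lemma congruence_entry:
  fixes P :: "real ^ 'n::finite ^ 'm::finite"
  shows "(transpose P ** X ** P) $ i $ j = (\<Sum>k\<in>UNIV. \<Sum>l\<in>UNIV. P $ k $ i * X $ k $ l * P $ l $ j)"
  by (simp add: matrix_matrix_mult_def transpose_def sum_distrib_right)
    (rule sum.swap)

lemma BTH_doubled:
  fixes E :: "'v::finite set set"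
  assumes "simple_graph E"
  shows "BTH (completion (doubled E)) = TH E"
proof (intro equalityI subsetI)
  let ?C = "conflict_graph (completion (doubled E))"
  fix x assume "x \<in> BTH (completion (doubled E))"
  then obtain y Y where x: "x = proj y" and psd: "psd (bordered y Y)"
    and diag: "\<And>p. Y $ p $ p = y $ p" and zero: "\<And>p q. {p, q} \<in> ?C \<Longrightarrow> Y $ p $ q = 0"
    by (auto simp: BTH_def TH_def)
  \<comment> \<open>The incidence matrix of sign pairs over base vertices: its transpose acts as
    \<open>proj\<close>, and the congruence adds up the four sign entries of \<open>Y\<close> over
    each pair of vertices.\<close>
  define P :: "real ^ 'v ^ ('v \<times> sign)" where "P = (\<chi> p v. of_bool (fst p = v))"
  define X where "X = transpose P ** Y ** P"
  have Px: "transpose P *v y = x"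
    by (simp add: x vec_eq_iff matrix_vector_mult_def transpose_def P_def proj_def
        sum_UNIV_times_sign sum.distrib of_bool_def if_distrib[of "\<lambda>c. c * _"] cong: if_cong)
  have X: "X $ u $ v = (\<Sum>s\<in>UNIV. \<Sum>r\<in>UNIV. Y $ (u, s) $ (v, r))" for u v
    by (simp add: X_def congruence_entry P_def sum_UNIV_times_sign sum_UNIV_sign sum.distrib
        of_bool_def if_distrib[of "\<lambda>c. c * _"] if_distrib[of "\<lambda>c. _ * c"] cong: if_cong)
  have "psd (bordered x X)"
    using psd_bordered_congruence[OF psd, of P] unfolding Px X_def .
  \<comment> \<open>The two mixed-sign entries vanish because \<open>(v, Positive)\<close> and
    \<open>(v, Negative)\<close> are adjacent; the other two add up to \<open>x $ v\<close>.\<close>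
  moreover have "X $ v $ v = x $ v" for v
    using assms by (simp add: X sum_UNIV_sign diag zero x proj_def conflict_graph_doubled_iff)
  moreover have "X $ u $ v = 0" if "{u, v} \<in> E" for u v
    using assms that by (simp add: X zero conflict_graph_doubled_iff)
  ultimately show "x \<in> TH E"
    by (auto simp: TH_def psd_bordered_iff)
next
  let ?C = "conflict_graph (completion (doubled E))"
  fix x assume "x \<in> TH E"
  then obtain X where psd: "psd (bordered x X)" and diag: "\<And>v. X $ v $ v = x $ v"
    and zero: "\<And>u v. {u, v} \<in> E \<Longrightarrow> X $ u $ v = 0"
    by (auto simp: TH_def)
  \<comment> \<open>Here the transpose of \<open>P\<close> is the section of \<open>proj\<close>
    that places \<open>x\<close> on the positive copy and zero on the negative one.\<close>
  define P :: "real ^ ('v \<times> sign) ^ 'v" where "P = (\<chi> v p. of_bool (p = (v, Positive)))"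
  define y where "y = transpose P *v x"
  define Y where "Y = transpose P ** X ** P"
  have y: "y $ (v, s) = of_bool (s = Positive) * x $ v" for v s
    by (simp add: y_def matrix_vector_mult_def transpose_def P_def of_bool_def
        if_distrib[of "\<lambda>c. c * _"] cong: if_cong)
  have Y: "Y $ (u, s) $ (v, r) = of_bool (s = Positive \<and> r = Positive) * X $ u $ v" for u v s r
    by (cases s; cases r; simp add: Y_def congruence_entry P_def of_bool_def
        if_distrib[of "\<lambda>c. c * _"] if_distrib[of "\<lambda>c. _ * c"] cong: if_cong)
  have "psd (bordered y Y)"
    using psd_bordered_congruence[OF psd] by (simp add: y_def Y_def)
  moreover have "Y $ p $ p = y $ p" for p
    by (cases p) (simp add: y Y diag)
  \<comment> \<open>An edge over a single vertex has a negative end, where \<open>Y\<close> is zero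
    by construction; any other edge lies over an edge of \<open>E\<close>.\<close>
  moreover have "Y $ p $ q = 0" if "{p, q} \<in> ?C" for p q
    using that assms by (cases p; cases q) (auto simp: Y zero conflict_graph_doubled_iff)
  ultimately have "y \<in> TH ?C"
    by (auto simp: TH_def psd_bordered_iff)
  moreover have "x = proj y"
    by (simp add: proj_def vec_eq_iff y)
  ultimately show "x \<in> BTH (completion (doubled E))"
    by (simp add: BTH_def)
qed

lemma BQSTAB_doubled:
  fixes E :: "'v::finite set set"
  assumes "simple_graph E"
  shows "BQSTAB (completion (doubled E)) = QSTAB E"
proof (intro equalityI subsetI)
  let ?C = "conflict_graph (completion (doubled E))"
  fix x assume "x \<in> BQSTAB (completion (doubled E))"
  then obtain y where x: "x = proj y" and nonneg: "\<And>p. 0 \<le> y $ p"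
    and le1: "\<And>K. clique K ?C \<Longrightarrow> (\<Sum>p\<in>K. y $ p) \<le> 1"
    by (auto simp: BQSTAB_def QSTAB_def)
  have "(\<Sum>v\<in>K. x $ v) \<le> 1" if "clique K E" for K
  proof -
    \<comment> \<open>A clique lifts together with both signs of each vertex, so its constraint on
      \<open>y\<close> is exactly the one wanted for \<open>proj y\<close>.\<close>
    have "clique (K \<times> UNIV) ?C"
      using that assms by (auto simp: clique_def conflict_graph_doubled_iff)
    from le1[OF this] show ?thesis
      by (simp add: x proj_def sum_times_sign)
  qed
  then show "x \<in> QSTAB E"
    by (simp add: QSTAB_def x proj_def nonneg)
next
  let ?C = "conflict_graph (completion (doubled E))"
  fix x assume x: "x \<in> QSTAB E"
  define y :: "real ^ ('v \<times> sign)" where "y = (\<chi> p. of_bool (snd p = Positive) * x $ fst p)"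
  have "(\<Sum>p\<in>K. y $ p) \<le> 1" if "clique K ?C" for K
  proof -
    \<comment> \<open>Only the positive part of \<open>K\<close> contributes to the sum, since
      \<open>y\<close> is zero on the negative copy.\<close>
    define L where "L = {v. (v, Positive) \<in> K}"
    have "(\<Sum>p\<in>K. y $ p) = (\<Sum>p\<in>(\<lambda>v. (v, Positive)) ` L. y $ p)"
      by (rule sum.mono_neutral_right) (auto simp: y_def L_def image_iff)
    also have "\<dots> = (\<Sum>v\<in>L. x $ v)"
      by (subst sum.reindex) (simp_all add: inj_on_def y_def)
    \<comment> \<open>Distinct vertices of \<open>L\<close> are adjacent in \<open>?C\<close> with
      equal signs, so the adjacency comes from \<open>E\<close>.\<close>
    also have "clique L E"
      using that assms by (fastforce simp: clique_def L_def conflict_graph_doubled_iff)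
    then have "(\<Sum>v\<in>L. x $ v) \<le> 1"
      using x by (simp add: QSTAB_def)
    finally show ?thesis .
  qed
  moreover have "0 \<le> y $ p" for p
    using x by (simp add: y_def QSTAB_def)
  ultimately have "y \<in> QSTAB ?C"
    by (simp add: QSTAB_def)
  moreover have "x = proj y"
    by (simp add: proj_def vec_eq_iff y_def)
  ultimately show "x \<in> BQSTAB (completion (doubled E))"
    by (simp add: BQSTAB_def)
qed

theorem theorem7p5:
  fixes E :: "'v::finite set set"
  assumes "simple_graph E"
  shows "BSTAB (completion (doubled E)) = STAB E
    \<and> BTH (completion (doubled E)) = TH E
    \<and> BQSTAB (completion (doubled E)) = QSTAB E"
  using assms
  by (simp add: BSTAB_def STAB_def balanced_set_doubled_iff BTH_doubled BQSTAB_doubled)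

end
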